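(* Let $f:\mathbb{R}\to\mathbb{R}$ and $\beta>0$ satisfy $f(\beta)\le0\le f(-\beta)$, and suppose $\|u_0\|_{L^\infty}\le\beta$. Let $\{\boldsymbol U_m\}_{m=0}^M$ be generated from $\boldsymbol U_0=(u_0(x_1),\dots,u_0(x_N))^T$ in one of the following two situations. (1) $f$ is continuously differentiable and nonconstant on $[-\beta,\beta]$, $0<\Delta t\le\omega_0$, and $\{\boldsymbol U_m\}$ is generated by the LRI1a scheme $\boldsymbol U_{m+1}=e^{\Delta t\boldsymbol A}(\boldsymbol U_m+\Delta t\,\boldsymbol f(\boldsymbol U_m))$ or by the LRI1b scheme $\boldsymbol U_{m+1}=e^{\Delta t\boldsymbol A}\boldsymbol U_m+\Delta t\,\boldsymbol f(e^{\Delta t\boldsymbol A}\boldsymbol U_m)$, $m=0,\dots,M-1$. (2) $f$ is twice continuously differentiable and nonconstant on $[-\beta,\beta]$, $0<\Delta t\le\delta_0\omega_0$, and $\{\boldsymbol U_m\}$ is generated by the LRI2 scheme $$\boldsymbol U_{m+1}=e^{\Delta t\boldsymbol A}\boldsymbol U_m+\frac{\Delta t}{2}\Bigl[e^{\Delta t\boldsymbol A}\boldsymbol f(\boldsymbol U_m)+\boldsymbol f(e^{\Delta t\boldsymbol A}\boldsymbol U_m)\Bigr]+\frac{\Delta t^2}{2}e^{\Delta t\boldsymbol A}\frac{\partial\boldsymbol f}{\partial\boldsymbol u}(\boldsymbol U_m)\boldsymbol f(\boldsymbol U_m),\quad m=0,\dots,M-1.$$ Then the numerical solution satisfies $$E_h(\boldsymbol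 U_m)\le E_h(\boldsymbol U_0)+C,\qquad m=0,1,\dots,M,$$ where the constant $C>0$ is independent of $\Delta t$ (and of $m$).
   Context: Setting (space discretization by central finite differences, homogeneous Neumann boundary conditions, of $\partial_t u=\varepsilon^2\Delta u+f(u)$ on $\Omega$ with initial datum $u_0:\overline\Omega\to\mathbb{R}$): $d\in\{1,2,3\}$, $\Omega\subset\mathbb{R}^d$ is an open bounded interval ($d=1$), rectangle ($d=2$) or rectangular parallelepiped ($d=3$), $\varepsilon>0$. A uniform grid with fixed mesh size $h>0$ in every direction is used, with $n_k\ge2$ grid points (boundary points included) in direction $k$, $N=n_1\cdots n_d$, and grid points $x_1,\dots,x_N\in\overline\Omega$ (first coordinate varying fastest). For $n\ge 2$ let $\boldsymbol\lambda_h^{(n)}$ be $\frac1{h^2}$ times the $n\times n$ tridiagonal matrix with all diagonal entries $-2$, first row $(-2,2,0,\dots,0)$, last row $(0,\dots,0,2,-2)$, and every interior row having entries $1,-2,1$ in the sub-, main and superdiagonal positions. Set $\boldsymbol D_h=\boldsymbol\lambda_h^{(n_1)}$ if $d=1$; $\boldsymbol D_h=\boldsymbol I\otimes\boldsymbol\lambda_h^{(n_1)}+\boldsymbol\lambda_h^{(n_2)}\otimes\boldsymbol I$ if $d=2$; $\boldsymbol D_h=\boldsymbol I\otimes\boldsymbol I\otimes\boldsymbol\lambda_h^{(n_1)}+\boldsymbol I\otimes\boldsymbol\lambda_h^{(n_2)}\otimes\boldsymbol I+\boldsymbol\lambda_h^{(n_3)}\otimes\boldsymbol I\otimes\boldsymbol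 I$ if $d=3$ ($\otimes$ is the Kronecker product, $\boldsymbol I$ identity matrices of the appropriate sizes), and $\boldsymbol A=\varepsilon^2\boldsymbol D_h\in\mathbb{R}^{N\times N}$. Time grid: $T>0$ is fixed, $M$ is a positive integer, $\Delta t=T/M$, $t_m=m\Delta t$. Discrete energy: $F$ is a potential function with $F'=-f$, and for $\boldsymbol U=(U^1,\dots,U^N)^T\in\mathbb{R}^N$, $$E_h(\boldsymbol U)=\sum_{i=1}^N F(U^i)-\frac{\varepsilon^2}{2}\boldsymbol U^T\boldsymbol D_h\boldsymbol U.$$ Constants: $\omega_0=-1/\min_{|x|\le\beta}f'(x)>0$ (the minimum is negative); when $f$ is twice continuously differentiable on $[-\beta,\beta]$, $\omega_1=-\min_{|x|\le\beta}[f''(x)f(x)]$, and $\delta_0=\min\{1,\delta\}$ with $\delta=\frac{-1+\sqrt{1+7\omega_0^2\omega_1}}{2\omega_0^2\omega_1}$ if $\omega_1>0$, while $\delta_0=1$ if $\omega_1\le0$. Notation: $\boldsymbol f(\boldsymbol v)=(f(v_1),\dots,f(v_N))^T$ and $\frac{\partial\boldsymbol f}{\partial\boldsymbol u}(\boldsymbol v)=\mathrm{diag}(f'(v_1),\dots,f'(v_N))$ for $\boldsymbol v\in\mathbb{R}^N$; $\|u_0\|_{L^\infty}=\max_{x\in\overline\Omega}|u_0(x)|$. *)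

theory Defs
  imports Complex_Main "HOL-Library.Extended_Real" "Jordan_Normal_Form.Matrix"
begin

text \<open>Standard block convention: the indices of the left factor are the most significant ones.\<close>

definition kron :: "real mat \<Rightarrow> real mat \<Rightarrow> real mat" where
  "kron A B = Matrix.mat (dim_row A * dim_row B) (dim_col A * dim_col B)
     (\<lambda>(i, j). A $$ (i div dim_row B, j div dim_col B) * B $$ (i mod dim_row B, j mod dim_col B))"

text \<open>The exponential series of a square matrix, summed entrywise (it always converges).\<close>

definition mat_exp :: "real mat \<Rightarrow> real mat" where
  "mat_exp A = Matrix.mat (dim_row A) (dim_row A)
     (\<lambda>(i, j). \<Sum>k. (A ^\<^sub>m k) $$ (i, j) / fact k)"

text \<open>
  A grid is given by the list \<open>ns = [n\<^sub>1, \<dots>, n\<^sub>d]\<close> of the numbers of grid points per direction.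
  Coordinates, grid points and matrix rows are numbered from 0.
  The domain \<open>\<Omega>\<close> is the open box with opposite corners \<open>a\<close> and \<open>b\<close>; its closure
  is the set of all \<open>x\<close> of dimension \<open>d\<close> with \<open>a \<le> x \<le> b\<close> componentwise.
\<close>

definition closed_domain :: "real Matrix.vec \<Rightarrow> real Matrix.vec \<Rightarrow> real Matrix.vec set" where
  "closed_domain a b =
     {x \<in> carrier_vec (dim_vec a). \<forall>k<dim_vec a. a $ k \<le> x $ k \<and> x $ k \<le> b $ k}"

definition uniform_grid ::
  "nat \<Rightarrow> real \<Rightarrow> nat list \<Rightarrow> real Matrix.vec \<Rightarrow> real Matrix.vec \<Rightarrow> bool" where
  "uniform_grid d h ns a b \<longleftrightarrow>
     length ns = d \<and> a \<in> carrier_vec d \<and> b \<in> carrier_vec d \<and> h > 0 \<and>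
     (\<forall>k<d. ns ! k \<ge> 2 \<and> b $ k - a $ k = h * (real (ns ! k) - 1))"

text \<open>The first coordinate varies fastest:
  \<open>i = i\<^sub>0 + n\<^sub>1 * i\<^sub>1 + n\<^sub>1 * n\<^sub>2 * i\<^sub>2\<close> with \<open>i\<^sub>k < ns ! k\<close>.\<close>

definition grid_point :: "real \<Rightarrow> nat list \<Rightarrow> real Matrix.vec \<Rightarrow> nat \<Rightarrow> real Matrix.vec" where
  "grid_point h ns a i =
     Matrix.vec (length ns) (\<lambda>k. a $ k + h * real (i div prod_list (take k ns) mod (ns ! k)))"

definition grid_values ::
  "real \<Rightarrow> nat list \<Rightarrow> real Matrix.vec \<Rightarrow> (real Matrix.vec \<Rightarrow> real) \<Rightarrow> real Matrix.vec" where
  "grid_values h ns a u = Matrix.vec (prod_list ns) (\<lambda>i. u (grid_point h ns a i))"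

text \<open>Extended-real valued, so that it is meaningful for an unbounded \<open>u\<close> as well.\<close>

definition sup_norm_on :: "'a set \<Rightarrow> ('a \<Rightarrow> real) \<Rightarrow> ereal" where
  "sup_norm_on S u = (SUP x\<in>S. ereal \<bar>u x\<bar>)"

definition lambda_mat :: "real \<Rightarrow> nat \<Rightarrow> real mat" where
  "lambda_mat h n = (1 / h\<^sup>2) \<cdot>\<^sub>m Matrix.mat n n (\<lambda>(i, j).
     if i = j then -2
     else if i = 0 \<and> j = 1 then 2
     else if i = n - 1 \<and> j = n - 2 then 2
     else if j = i + 1 \<or> i = j + 1 then 1
     else 0)"

fun D_mat :: "real \<Rightarrow> nat list \<Rightarrow> real mat" where
  "D_mat h [n1] = lambda_mat h n1"
| "D_mat h [n1, n2] =
     kron (1\<^sub>m n2) (lambda_mat h n1) + kron (lambda_mat h n2) (1\<^sub>m n1)"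
| "D_mat h [n1, n2, n3] =
     kron (1\<^sub>m n3) (kron (1\<^sub>m n2) (lambda_mat h n1))
     + kron (1\<^sub>m n3) (kron (lambda_mat h n2) (1\<^sub>m n1))
     + kron (lambda_mat h n3) (kron (1\<^sub>m n2) (1\<^sub>m n1))"

definition A_mat :: "real \<Rightarrow> real \<Rightarrow> nat list \<Rightarrow> real mat" where
  "A_mat eps h ns = eps\<^sup>2 \<cdot>\<^sub>m D_mat h ns"

definition discrete_energy ::
  "(real \<Rightarrow> real) \<Rightarrow> real \<Rightarrow> real \<Rightarrow> nat list \<Rightarrow> real Matrix.vec \<Rightarrow> real" where
  "discrete_energy F eps h ns U =
     (\<Sum>i<prod_list ns. F (U $ i)) - eps\<^sup>2 / 2 * scalar_prod U (D_mat h ns *\<^sub>v U)"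

text \<open>Derivatives on \<open>S\<close> are taken relative to \<open>S\<close>, i.e. one-sided at the end points of an interval.\<close>

definition is_deriv_on :: "(real \<Rightarrow> real) \<Rightarrow> (real \<Rightarrow> real) \<Rightarrow> real set \<Rightarrow> bool" where
  "is_deriv_on g g' S \<longleftrightarrow> (\<forall>x\<in>S. (g has_real_derivative g' x) (at x within S))"

definition C1_deriv_on :: "(real \<Rightarrow> real) \<Rightarrow> (real \<Rightarrow> real) \<Rightarrow> real set \<Rightarrow> bool" where
  "C1_deriv_on g g' S \<longleftrightarrow> is_deriv_on g g' S \<and> continuous_on S g'"

definition nonconstant_on :: "(real \<Rightarrow> real) \<Rightarrow> real set \<Rightarrow> bool" where
  "nonconstant_on g S \<longleftrightarrow> \<not> (\<exists>c. \<forall>x\<in>S. g x = c)"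

text \<open>
  In the constants below, \<open>f'\<close> and \<open>f''\<close> are the first two derivatives of \<open>f\<close> on
  \<open>[-\<beta>, \<beta>]\<close>. They are continuous there whenever the constants are used, so each infimum is a minimum.
\<close>

definition omega0 :: "real \<Rightarrow> (real \<Rightarrow> real) \<Rightarrow> real" where
  "omega0 \<beta> f' = - 1 / (INF x\<in>{-\<beta>..\<beta>}. f' x)"

definition omega1 :: "real \<Rightarrow> (real \<Rightarrow> real) \<Rightarrow> (real \<Rightarrow> real) \<Rightarrow> real" where
  "omega1 \<beta> f f'' = - (INF x\<in>{-\<beta>..\<beta>}. f'' x * f x)"

definition delta0 :: "real \<Rightarrow> (real \<Rightarrow> real) \<Rightarrow> (real \<Rightarrow> real) \<Rightarrow> (real \<Rightarrow> real) \<Rightarrow> real" where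
  "delta0 \<beta> f f' f'' =
     (let w0 = omega0 \<beta> f'; w1 = omega1 \<beta> f f'' in
      if w1 > 0 then min 1 ((- 1 + sqrt (1 + 7 * w0\<^sup>2 * w1)) / (2 * w0\<^sup>2 * w1)) else 1)"

definition jacobian_vec :: "(real \<Rightarrow> real) \<Rightarrow> real Matrix.vec \<Rightarrow> real mat" where
  "jacobian_vec f' v = mat_diag (dim_vec v) (\<lambda>i. f' (v $ i))"

definition LRI1a_step ::
  "real mat \<Rightarrow> (real \<Rightarrow> real) \<Rightarrow> real \<Rightarrow> real Matrix.vec \<Rightarrow> real Matrix.vec" where
  "LRI1a_step A f dt U = mat_exp (dt \<cdot>\<^sub>m A) *\<^sub>v (U + dt \<cdot>\<^sub>v map_vec f U)"

definition LRI1b_step ::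
  "real mat \<Rightarrow> (real \<Rightarrow> real) \<Rightarrow> real \<Rightarrow> real Matrix.vec \<Rightarrow> real Matrix.vec" where
  "LRI1b_step A f dt U =
     mat_exp (dt \<cdot>\<^sub>m A) *\<^sub>v U + dt \<cdot>\<^sub>v map_vec f (mat_exp (dt \<cdot>\<^sub>m A) *\<^sub>v U)"

definition LRI2_step ::
  "real mat \<Rightarrow> (real \<Rightarrow> real) \<Rightarrow> (real \<Rightarrow> real) \<Rightarrow> real \<Rightarrow> real Matrix.vec \<Rightarrow> real Matrix.vec" where
  "LRI2_step A f f' dt U =
     mat_exp (dt \<cdot>\<^sub>m A) *\<^sub>v U
     + (dt / 2) \<cdot>\<^sub>v (mat_exp (dt \<cdot>\<^sub>m A) *\<^sub>v map_vec f U
                     + map_vec f (mat_exp (dt \<cdot>\<^sub>m A) *\<^sub>v U))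
     + (dt\<^sup>2 / 2) \<cdot>\<^sub>v (mat_exp (dt \<cdot>\<^sub>m A) *\<^sub>v (jacobian_vec f' U *\<^sub>v map_vec f U))"

definition generated_by ::
  "(real Matrix.vec \<Rightarrow> real Matrix.vec) \<Rightarrow> nat \<Rightarrow> (nat \<Rightarrow> real Matrix.vec) \<Rightarrow> bool" where
  "generated_by step M U \<longleftrightarrow> (\<forall>m<M. U (Suc m) = step (U m))"

end

theory Submission
  imports Defs
begin

text \<open>
  On the box \<open>[-\<beta>, \<beta>]\<^sup>N\<close> the discrete energy is bounded, so it suffices that all schemes
  leave this box invariant. The matrix \<open>A\<close> has nonnegative off-diagonal entries and vanishing row
  sums, hence \<open>exp (dt A)\<close> is row stochastic and maps the box into itself. The nonlinear parts of
  the schemes are handled by scalar functions that are nondecreasing on \<open>[-\<beta>, \<beta>]\<close>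
  thanks to the bound on the time step, and which therefore only have to be controlled at \<open>\<plusminus>\<beta>\<close>.
\<close>

section \<open>Exponentials of matrices with vanishing row sums\<close>

text \<open>Generator of a continuous-time Markov chain. The diagonal is nonpositive automatically,
  because the row sums vanish and all other entries are nonnegative.\<close>

definition rate_matrix :: "nat \<Rightarrow> real mat \<Rightarrow> bool" where
  "rate_matrix n A \<longleftrightarrow> A \<in> carrier_mat n n \<and>
     (\<forall>i<n. \<forall>j<n. i \<noteq> j \<longrightarrow> 0 \<le> A $$ (i, j)) \<and> (\<forall>i<n. (\<Sum>j<n. A $$ (i, j)) = 0)"

definition row_stochastic :: "nat \<Rightarrow> real mat \<Rightarrow> bool" where
  "row_stochastic n P \<longleftrightarrow> P \<in> carrier_mat n n \<and>
     (\<forall>i<n. \<forall>j<n. 0 \<le> P $$ (i, j)) \<and> (\<forall>i<n. (\<Sum>j<n. P $$ (i, j)) = 1)"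

section \<open>Entries and row sums of matrix products and powers\<close>

lemma mult_mat_entry:
  assumes "A \<in> carrier_mat n n" "B \<in> carrier_mat n n" "i < n" "j < n"
  shows "(A * B) $$ (i, j) = (\<Sum>k<n. A $$ (i, k) * B $$ (k, j))"
  using assms by (simp add: scalar_prod_def lessThan_atLeast0)

lemma mult_mat_vec_entry:
  assumes "A \<in> carrier_mat n n" "v \<in> carrier_vec n" "i < n"
  shows "(A *\<^sub>v v) $ i = (\<Sum>k<n. A $$ (i, k) * v $ k)"
  using assms by (simp add: scalar_prod_def lessThan_atLeast0)

lemma pow_mat_Suc_entry:
  assumes "(A :: real mat) \<in> carrier_mat n n" "i < n" "j < n"
  shows "(A ^\<^sub>m Suc k) $$ (i, j) = (\<Sum>l<n. (A ^\<^sub>m k) $$ (i, l) * A $$ (l, j))"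
  using mult_mat_entry[OF pow_carrier_mat[OF assms(1)] assms] by simp

text \<open>The all-ones vector is an eigenvector of \<open>A\<close> with eigenvalue
  \<open>r\<close>. Applied with \<open>r = c\<close> to bound the entries of the powers of a
  nonnegative matrix, and with \<open>r = 0\<close> to compute the row sums of the
  exponential.\<close>

lemma pow_mat_row_sum:
  assumes A: "(A :: real mat) \<in> carrier_mat n n"
    and r: "\<And>i. i < n \<Longrightarrow> (\<Sum>j<n. A $$ (i, j)) = r" and i: "i < n"
  shows "(\<Sum>j<n. (A ^\<^sub>m k) $$ (i, j)) = r ^ k"
proof (induction k)
  case 0
  then show ?case using i A by (simp add: sum.delta')
next
  case (Suc k)
  have "(\<Sum>j<n. (A ^\<^sub>m Suc k) $$ (i, j)) = (\<Sum>j<n. \<Sum>l<n. (A ^\<^sub>m k) $$ (i, l) * A $$ (l, j))"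
    using pow_mat_Suc_entry[OF A i] by (intro sum.cong) (simp_all del: pow_mat.simps)
  also have "\<dots> = (\<Sum>l<n. (A ^\<^sub>m k) $$ (i, l) * (\<Sum>j<n. A $$ (l, j)))"
    by (subst sum.swap) (simp add: sum_distrib_left)
  also have "\<dots> = (\<Sum>l<n. (A ^\<^sub>m k) $$ (i, l)) * r"
    using r by (simp add: sum_distrib_right)
  finally show ?case using Suc by simp
qed

lemma pow_mat_nonneg:
  assumes A: "(A :: real mat) \<in> carrier_mat n n"
    and nn: "\<And>i j. i < n \<Longrightarrow> j < n \<Longrightarrow> 0 \<le> A $$ (i, j)" and i: "i < n" and "j < n"
  shows "0 \<le> (A ^\<^sub>m k) $$ (i, j)"
  using \<open>j < n\<close>
proof (induction k arbitrary: j)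
  case 0
  then show ?case using i A by simp
next
  case (Suc k)
  show ?case
    unfolding pow_mat_Suc_entry[OF A i Suc.prems]
    using Suc nn by (intro sum_nonneg mult_nonneg_nonneg) auto
qed

text \<open>Binomial theorem for \<open>B + x I\<close>, valid because \<open>x I\<close> commutes
  with \<open>B\<close>. The entrywise form lets the exponential be treated as a family of scalar
  series.\<close>

lemma pow_mat_shift_entry:
  assumes B: "(B :: real mat) \<in> carrier_mat n n" and A: "A \<in> carrier_mat n n"
    and AB: "\<And>i j. i < n \<Longrightarrow> j < n \<Longrightarrow> A $$ (i, j) = B $$ (i, j) + (if i = j then x else 0)"
    and i: "i < n" and "j < n"
  shows "(A ^\<^sub>m k) $$ (i, j) = (\<Sum>l\<le>k. of_nat (k choose l) * (B ^\<^sub>m l) $$ (i, j) * x ^ (k - l))"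
  using \<open>j < n\<close>
proof (induction k arbitrary: j)
  case 0
  then show ?case using i A B by simp
next
  case (Suc k)
  let ?b = "\<lambda>l. (B ^\<^sub>m l) $$ (i, j)"
  have "(A ^\<^sub>m Suc k) $$ (i, j)
      = (\<Sum>m<n. (A ^\<^sub>m k) $$ (i, m) * B $$ (m, j) + (if m = j then x * (A ^\<^sub>m k) $$ (i, m) else 0))"
    unfolding pow_mat_Suc_entry[OF A i Suc.prems]
    using AB Suc.prems by (intro sum.cong) (auto simp: algebra_simps)
  also have "\<dots> = (\<Sum>m<n. (A ^\<^sub>m k) $$ (i, m) * B $$ (m, j)) + x * (A ^\<^sub>m k) $$ (i, j)"
    using Suc.prems by (simp add: sum.distrib)
  also have "(\<Sum>m<n. (A ^\<^sub>m k) $$ (i, m) * B $$ (m, j))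
      = (\<Sum>m<n. \<Sum>l\<le>k. of_nat (k choose l) * x ^ (k - l) * ((B ^\<^sub>m l) $$ (i, m) * B $$ (m, j)))"
    using Suc.IH by (simp add: sum_distrib_right sum_distrib_left mult_ac)
  also have "\<dots> = (\<Sum>l\<le>k. of_nat (k choose l) * x ^ (k - l) * ?b (Suc l))"
    by (subst sum.swap)
      (simp add: pow_mat_Suc_entry[OF B i Suc.prems] sum_distrib_left[symmetric] del: pow_mat.simps)
  also have "x * (A ^\<^sub>m k) $$ (i, j) = (\<Sum>l\<le>k. of_nat (k choose l) * x ^ (Suc k - l) * ?b l)"
    unfolding Suc.IH[OF Suc.prems] sum_distrib_left
    by (intro sum.cong) (auto simp: Suc_diff_le mult_ac)
  also have "\<dots> = x ^ Suc k * ?b 0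
      + (\<Sum>l\<le>k. of_nat (k choose Suc l) * x ^ (k - l) * ?b (Suc l))"
  proof -
    \<comment> \<open>The added term \<open>l = Suc k\<close> is zero since its binomial coefficient
      vanishes; the longer sum can then be split at \<open>l = 0\<close> and shifted.\<close>
    have "(\<Sum>l\<le>k. of_nat (k choose l) * x ^ (Suc k - l) * ?b l)
        = (\<Sum>l\<le>Suc k. of_nat (k choose l) * x ^ (Suc k - l) * ?b l)"
      by (simp add: binomial_eq_0)
    then show ?thesis
      by (simp add: sum.atMost_Suc_shift del: pow_mat.simps sum.atMost_Suc)
  qed
  \<comment> \<open>Pascal's rule merges the two sums over \<open>?b (Suc l)\<close>.\<close>
  also have "(\<Sum>l\<le>k. of_nat (k choose l) * x ^ (k - l) * ?b (Suc l))
      + (x ^ Suc k * ?b 0 + (\<Sum>l\<le>k. of_nat (k choose Suc l) * x ^ (k - l) * ?b (Suc l)))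
      = (\<Sum>l\<le>Suc k. of_nat (Suc k choose l) * ?b l * x ^ (Suc k - l))"
    by (simp add: sum.atMost_Suc_shift sum.distrib algebra_simps
        del: pow_mat.simps sum.atMost_Suc)
  finally show ?case .
qed

text \<open>
  Write \<open>A = B - c I\<close> with \<open>B\<close> entrywise nonnegative. Then \<open>exp A = e\<^sup>-\<^sup>c exp B\<close>,
  here via the Cauchy product of the two entrywise series.
\<close>

lemma rate_matrix_exp_entry:
  assumes Q: "rate_matrix n A" and i: "i < n" and j: "j < n"
  shows "summable (\<lambda>k. (A ^\<^sub>m k) $$ (i, j) / fact k)"
    and "0 \<le> (\<Sum>k. (A ^\<^sub>m k) $$ (i, j) / fact k)"
proof -
  have A: "A \<in> carrier_mat n n" using Q by (simp add: rate_matrix_def)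
  \<comment> \<open>This sum dominates every single diagonal entry in absolute value, so adding
    \<open>c\<close> to the diagonal makes it nonnegative. It is also the common row sum of
    \<open>B\<close>.\<close>
  define c where "c = (\<Sum>i<n. \<bar>A $$ (i, i)\<bar>)"
  define B where "B = A + c \<cdot>\<^sub>m 1\<^sub>m n"
  have B: "B \<in> carrier_mat n n" using A by (simp add: B_def)
  have Bij: "B $$ (i, j) = A $$ (i, j) + (if i = j then c else 0)" if "i < n" "j < n" for i j
    using that A by (simp add: B_def)
  have diag: "\<bar>A $$ (i, i)\<bar> \<le> c" if "i < n" for i
    using that unfolding c_def by (intro member_le_sum) auto
  have Bnn: "0 \<le> B $$ (i, j)" if "i < n" "j < n" for i j
    using that Q Bij[OF that] diag[of i] by (auto simp: rate_matrix_def)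
  have Brow: "(\<Sum>j<n. B $$ (i, j)) = c" if "i < n" for i
    using that Q by (simp add: Bij sum.distrib rate_matrix_def)
  let ?b = "\<lambda>l. (B ^\<^sub>m l) $$ (i, j)"
  have b0: "0 \<le> ?b l" for l using pow_mat_nonneg[OF B Bnn i j] .
  \<comment> \<open>By nonnegativity an entry of the power is at most its row sum
    \<open>c ^ l\<close>, so the exponential series of \<open>c\<close> is a majorant.\<close>
  have b1: "?b l \<le> c ^ l" for l
  proof -
    have "?b l \<le> (\<Sum>j<n. (B ^\<^sub>m l) $$ (i, j))"
      using j pow_mat_nonneg[OF B Bnn i] by (intro member_le_sum) auto
    then show ?thesis using pow_mat_row_sum[OF B Brow i] by simp
  qed
  have sB: "summable (\<lambda>l. ?b l / fact l)"
  proof (rule summable_comparison_test'[where N = 0])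
    show "summable (\<lambda>l. c ^ l / fact l)"
      using summable_exp[of c] by (simp add: divide_inverse mult.commute)
    show "norm (?b l / fact l) \<le> c ^ l / fact l" for l
      using b0[of l] b1[of l] by (simp add: divide_right_mono)
  qed
  have nB: "summable (\<lambda>l. norm (?b l / fact l))"
    using sB b0 by simp
  have nE: "summable (\<lambda>l. norm ((- c) ^ l / fact l))"
    using summable_norm_exp[of "- c"] by (simp add: divide_inverse mult.commute)
  have eq: "(A ^\<^sub>m k) $$ (i, j) / fact k
      = (\<Sum>l\<le>k. (?b l / fact l) * ((- c) ^ (k - l) / fact (k - l)))" for k
  proof -
    have "(A ^\<^sub>m k) $$ (i, j)
        = (\<Sum>l\<le>k. of_nat (k choose l) * ?b l * (- c) ^ (k - l))"
      by (rule pow_mat_shift_entry[OF B A _ i j]) (simp add: Bij)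
    then show ?thesis
      by (auto simp: sum_divide_distrib binomial_fact intro!: sum.cong)
  qed
  have "(\<Sum>l. (- c) ^ l / fact l) = exp (- c)"
    by (simp add: exp_def divide_inverse mult.commute)
  then have "(\<Sum>k. (A ^\<^sub>m k) $$ (i, j) / fact k) = (\<Sum>l. ?b l / fact l) * exp (- c)"
    unfolding eq using Cauchy_product[OF nB nE] by simp
  then show "0 \<le> (\<Sum>k. (A ^\<^sub>m k) $$ (i, j) / fact k)"
    using suminf_nonneg[OF sB] b0 by simp
  show "summable (\<lambda>k. (A ^\<^sub>m k) $$ (i, j) / fact k)"
    unfolding eq by (rule summable_Cauchy_product[OF nB nE])
qed

text \<open>The rows of the \<open>k\<close>-th power of \<open>A\<close> sum to
  \<open>0 ^ k\<close>, so only the identity term of the series contributes to the row sums of the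
  exponential.\<close>

lemma row_stochastic_mat_exp:
  assumes Q: "rate_matrix n A"
  shows "row_stochastic n (mat_exp A)"
proof -
  have A: "A \<in> carrier_mat n n" using Q by (simp add: rate_matrix_def)
  have "(\<Sum>j<n. mat_exp A $$ (i, j)) = 1" if i: "i < n" for i
  proof -
    have "(\<Sum>j<n. mat_exp A $$ (i, j)) = (\<Sum>j<n. \<Sum>k. (A ^\<^sub>m k) $$ (i, j) / fact k)"
      using A i by (simp add: mat_exp_def)
    also have "\<dots> = (\<Sum>k. \<Sum>j<n. (A ^\<^sub>m k) $$ (i, j) / fact k)"
      using rate_matrix_exp_entry(1)[OF Q i] by (intro suminf_sum[symmetric]) auto
    also have "\<dots> = (\<Sum>k. 0 ^ k / fact k)"
      using pow_mat_row_sum[OF A _ i, of 0] Q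
      by (simp add: sum_divide_distrib[symmetric] rate_matrix_def)
    also have "\<dots> = exp (0 :: real)"
      by (simp add: exp_def divide_inverse mult.commute)
    finally show ?thesis by simp
  qed
  then show ?thesis
    using A rate_matrix_exp_entry(2)[OF Q]
    by (auto simp: row_stochastic_def mat_exp_def)
qed

section \<open>The discrete Laplacian\<close>

lemma rate_matrix_smult:
  "rate_matrix n A \<Longrightarrow> 0 \<le> c \<Longrightarrow> rate_matrix n (c \<cdot>\<^sub>m A)"
  by (auto simp: rate_matrix_def sum_distrib_left[symmetric])

lemma rate_matrix_add:
  "rate_matrix n A \<Longrightarrow> rate_matrix n B \<Longrightarrow> rate_matrix n (A + B)"
  by (auto simp: rate_matrix_def sum.distrib)

section \<open>Kronecker products with identity matrices\<close>

lemma kron_carrier: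
  "A \<in> carrier_mat m m' \<Longrightarrow> B \<in> carrier_mat n n' \<Longrightarrow> kron A B \<in> carrier_mat (m * n) (m' * n')"
  by (auto simp: kron_def)

lemma kron_entry:
  assumes "A \<in> carrier_mat m m" "B \<in> carrier_mat n n" "i < m * n" "j < m * n"
  shows "kron A B $$ (i, j) = A $$ (i div n, j div n) * B $$ (i mod n, j mod n)"
  using assms by (auto simp: kron_def)

lemma div_mod_less:
  assumes "i < m * (n :: nat)"
  shows "i div n < m" "i mod n < n"
  using assms by (auto simp: less_mult_imp_div_less intro!: mod_less_divisor intro: Nat.gr0I)

text \<open>Cutting the column range into \<open>m\<close> blocks of length \<open>n\<close>, with
  \<open>j = k * n + l\<close>, makes the sum factor.\<close>

lemma kron_row_sum:
  assumes "A \<in> carrier_mat m m" "B \<in> carrier_mat n n" "i < m * n"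
  shows "(\<Sum>j<m * n. kron A B $$ (i, j))
    = (\<Sum>k<m. A $$ (i div n, k)) * (\<Sum>l<n. B $$ (i mod n, l))"
proof -
  let ?g = "\<lambda>j. A $$ (i div n, j div n) * B $$ (i mod n, j mod n)"
  have "(\<Sum>j<m * n. kron A B $$ (i, j)) = (\<Sum>j<m * n. ?g j)"
    using assms by (intro sum.cong) (auto simp: kron_entry)
  also have "\<dots> = (\<Sum>k<m. \<Sum>j = k * n..<k * n + n. ?g j)"
    by (rule sum.nat_group[symmetric])
  also have "\<dots> = (\<Sum>k<m. \<Sum>l<n. A $$ (i div n, k) * B $$ (i mod n, l))"
  proof (rule sum.cong[OF refl])
    fix k
    have "(\<Sum>j = k * n..<k * n + n. ?g j) = (\<Sum>l = 0..<n. ?g (l + k * n))"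
      using sum.shift_bounds_nat_ivl[of ?g 0 "k * n" n] by (simp add: add.commute)
    then show "(\<Sum>j = k * n..<k * n + n. ?g j) = (\<Sum>l<n. A $$ (i div n, k) * B $$ (i mod n, l))"
      by (simp add: lessThan_atLeast0)
  qed
  finally show ?thesis by (simp add: sum_product)
qed

lemma div_mod_neq:
  assumes "i \<noteq> (j :: nat)" "i div n = j div n"
  shows "i mod n \<noteq> j mod n"
  using assms by (metis div_mult_mod_eq)

text \<open>An entry outside the diagonal blocks is zero, and two distinct indices in the same block
  differ modulo \<open>n\<close>, hence select an off-diagonal entry of \<open>B\<close>. The row
  sums are \<open>1 * 0\<close>.\<close>

lemma rate_matrix_kron_one_left:
  assumes B: "rate_matrix n B"
  shows "rate_matrix (m * n) (kron (1\<^sub>m m) B)"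
proof -
  have Bc: "B \<in> carrier_mat n n" using B by (simp add: rate_matrix_def)
  have "0 \<le> kron (1\<^sub>m m) B $$ (i, j)" if "i < m * n" "j < m * n" "i \<noteq> j" for i j
    using that B div_mod_less[OF that(1)] div_mod_less[OF that(2)] div_mod_neq[OF that(3)]
    by (auto simp: kron_entry[OF one_carrier_mat Bc] rate_matrix_def)
  then show ?thesis
    using B kron_row_sum[OF one_carrier_mat Bc] kron_carrier[OF one_carrier_mat Bc, of m]
    by (auto simp: rate_matrix_def div_mod_less)
qed

lemma rate_matrix_kron_one_right:
  assumes B: "rate_matrix m B"
  shows "rate_matrix (m * n) (kron B (1\<^sub>m n))"
proof -
  have Bc: "B \<in> carrier_mat m m" using B by (simp add: rate_matrix_def)
  have "0 \<le> kron B (1\<^sub>m n) $$ (i, j)" if "i < m * n" "j < m * n" "i \<noteq> j" for i j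
    using that B div_mod_less[OF that(1)] div_mod_less[OF that(2)] div_mod_neq[OF that(3)]
    by (auto simp: kron_entry[OF Bc one_carrier_mat] rate_matrix_def)
  then show ?thesis
    using B kron_row_sum[OF Bc one_carrier_mat] kron_carrier[OF Bc one_carrier_mat, of n]
    by (auto simp: rate_matrix_def div_mod_less)
qed

text \<open>Reduces the last summand of the three-dimensional Laplacian, whose right factor is a
  product of two identities, to the case of a single identity factor.\<close>

lemma kron_one_one: "kron (1\<^sub>m m) (1\<^sub>m n) = 1\<^sub>m (m * n)"
proof (rule eq_matI)
  fix i j assume ij: "i < dim_row (1\<^sub>m (m * n) :: real mat)" "j < dim_col (1\<^sub>m (m * n) :: real mat)"
  then have "i < m * n" "j < m * n" by auto
  then show "kron (1\<^sub>m m) (1\<^sub>m n) $$ (i, j) = 1\<^sub>m (m * n) $$ (i, j)"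
    using div_mod_neq[of i j n] by (auto simp: kron_entry[of _ m _ n] div_mod_less)
qed (auto simp: kron_def)

text \<open>The doubled neighbour entry in the two Neumann boundary rows compensates for the missing
  neighbour, so these rows sum to zero like the interior ones.\<close>

lemma rate_matrix_lambda_mat:
  assumes "2 \<le> n"
  shows "rate_matrix n (lambda_mat h n)"
proof -
  define e :: "nat \<Rightarrow> nat \<Rightarrow> real" where
    "e i j = (if i = j then -2 else if i = 0 \<and> j = 1 then 2
       else if i = n - 1 \<and> j = n - 2 then 2 else if j = i + 1 \<or> i = j + 1 then 1 else 0)" for i j
  define L where "L = Matrix.mat n n (\<lambda>(i, j). e i j)"
  have row: "(\<Sum>j<n. e i j) = 0" if i: "i < n" for i
  proof -
    consider "i = 0" | "i > 0" "i = n - 1" | "i > 0" "i < n - 1" using i by linarith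
    then show ?thesis
    proof cases
      case 1
      have "(\<Sum>j<n. e i j) = (\<Sum>j\<in>{0, 1}. e i j)"
        using 1 assms by (intro sum.mono_neutral_right) (auto simp: e_def)
      then show ?thesis using 1 assms by (simp add: e_def)
    next
      case 2
      have "(\<Sum>j<n. e i j) = (\<Sum>j\<in>{n - 2, n - 1}. e i j)"
        using 2 assms by (intro sum.mono_neutral_right) (auto simp: e_def)
      then show ?thesis using 2 assms by (auto simp: e_def)
    next
      case 3
      \<comment> \<open>Writing the interior row index as a successor avoids truncated subtraction
        when naming its left neighbour.\<close>
      then obtain k where k: "i = Suc k" "Suc (Suc k) < n"
        by (cases i) auto
      have "(\<Sum>j<n. e i j) = (\<Sum>j\<in>{k, Suc k, Suc (Suc k)}. e i j)"
        using k by (intro sum.mono_neutral_right) (auto simp: e_def)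
      also have "\<dots> = e i k + (e i (Suc k) + e i (Suc (Suc k)))"
        by simp
      also have "\<dots> = 0"
        using k by (simp add: e_def)
      finally show ?thesis .
    qed
  qed
  have "rate_matrix n L"
    using row by (auto simp: rate_matrix_def L_def e_def)
  moreover have "lambda_mat h n = (1 / h\<^sup>2) \<cdot>\<^sub>m L"
    unfolding lambda_mat_def L_def e_def ..
  ultimately show ?thesis by (simp add: rate_matrix_smult)
qed

lemma rate_matrix_D_mat:
  assumes "length ns \<in> {1, 2, 3}" and "\<forall>k<length ns. 2 \<le> ns ! k"
  shows "rate_matrix (prod_list ns) (D_mat h ns)"
proof -
  have n2: "2 \<le> n" if "n \<in> set ns" for n
    using assms(2) that by (auto simp: in_set_conv_nth)
  consider n1 where "ns = [n1]" | n1 n2 where "ns = [n1, n2]" | n1 n2 n3 where "ns = [n1, n2, n3]"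
    using assms(1) by (auto simp: length_Suc_conv numeral_2_eq_2 numeral_3_eq_3)
  then show ?thesis
  proof cases
    case 1
    then show ?thesis using n2 by (simp add: rate_matrix_lambda_mat)
  next
    case (2 n1 n2')
    \<comment> \<open>The slowest coordinate is the left Kronecker factor, so the size appears in
      the order opposite to \<open>prod_list ns\<close>.\<close>
    have "rate_matrix (n2' * n1) (D_mat h ns)"
      using 2 n2 by (simp add: rate_matrix_lambda_mat rate_matrix_add
          rate_matrix_kron_one_left rate_matrix_kron_one_right)
    then show ?thesis using 2 by (simp add: mult.commute)
  next
    case (3 n1 n2' n3)
    have "rate_matrix (n3 * (n2' * n1)) (D_mat h ns)"
      using 3 n2 by (simp add: rate_matrix_lambda_mat rate_matrix_add kron_one_one
          rate_matrix_kron_one_left rate_matrix_kron_one_right)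
    then show ?thesis using 3 by (simp add: mult_ac)
  qed
qed

section \<open>Invariance of the box\<close>

definition box_vecs :: "nat \<Rightarrow> real \<Rightarrow> real Matrix.vec set" where
  "box_vecs n \<beta> = {v \<in> carrier_vec n. \<forall>i<n. \<bar>v $ i\<bar> \<le> \<beta>}"

text \<open>A convex combination cannot exceed a common bound of its terms. The values
  \<open>g j\<close> are arbitrary so that nonlinear expressions in the entries of a vector are
  covered as well.\<close>

lemma row_stochastic_average_bound:
  assumes P: "row_stochastic n P" and i: "i < n" and g: "\<And>j. j < n \<Longrightarrow> \<bar>g j\<bar> \<le> c"
  shows "\<bar>\<Sum>j<n. P $$ (i, j) * g j\<bar> \<le> c"
proof -
  have "\<bar>\<Sum>j<n. P $$ (i, j) * g j\<bar> \<le> (\<Sum>j<n. \<bar>P $$ (i, j) * g j\<bar>)" by (rule sum_abs)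
  also have "\<dots> \<le> (\<Sum>j<n. P $$ (i, j) * c)"
    using P i g by (intro sum_mono) (auto simp: row_stochastic_def abs_mult intro!: mult_left_mono)
  also have "\<dots> = c"
    using P i by (simp add: sum_distrib_right[symmetric] row_stochastic_def)
  finally show ?thesis .
qed

lemma row_stochastic_mult_box:
  assumes "row_stochastic n P" "v \<in> box_vecs n \<beta>"
  shows "P *\<^sub>v v \<in> box_vecs n \<beta>"
proof -
  have P: "P \<in> carrier_mat n n" and v: "v \<in> carrier_vec n"
    using assms by (auto simp: row_stochastic_def box_vecs_def)
  have "\<bar>(P *\<^sub>v v) $ i\<bar> \<le> \<beta>" if "i < n" for i
    unfolding mult_mat_vec_entry[OF P v that]
    using assms that by (intro row_stochastic_average_bound) (auto simp: box_vecs_def)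
  then show ?thesis
    using mult_mat_vec_carrier[OF P v] by (simp add: box_vecs_def del: index_mult_mat_vec)
qed

section \<open>Scalar maps that are nondecreasing on the interval\<close>

lemma is_deriv_on_nondecreasing:
  assumes d: "is_deriv_on g g' {a..b}" and nn: "\<And>x. x \<in> {a..b} \<Longrightarrow> 0 \<le> g' x"
    and "a \<le> x" "x \<le> y" "y \<le> b"
  shows "g x \<le> g y"
proof (rule DERIV_nonneg_imp_increasing_open[OF \<open>x \<le> y\<close>])
  fix z assume z: "x < z" "z < y"
  then have "(g has_real_derivative g' z) (at z within {a..b})"
    using d assms by (auto simp: is_deriv_on_def)
  \<comment> \<open>Only at interior points is the relative derivative a two-sided one; the end
    points are reached by continuity.\<close>
  moreover have "at z within {a..b} = at z"
    using z assms by (intro at_within_Icc_at) auto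
  ultimately show "\<exists>D. (g has_real_derivative D) (at z) \<and> 0 \<le> D"
    using nn[of z] z assms by auto
next
  have "continuous_on {a..b} g"
    using d by (auto simp: is_deriv_on_def intro: DERIV_continuous_on)
  then show "continuous_on {x..y} g"
    using assms by (auto intro: continuous_on_subset)
qed

lemma is_deriv_on_abs_bound:
  assumes "is_deriv_on g g' {-\<beta>..\<beta>}" "\<And>x. x \<in> {-\<beta>..\<beta>} \<Longrightarrow> 0 \<le> g' x"
    and "g \<beta> \<le> c" "- c \<le> g (- \<beta>)" and "\<bar>x\<bar> \<le> \<beta>"
  shows "\<bar>g x\<bar> \<le> c"
proof -
  have "- \<beta> \<le> x" "x \<le> \<beta>" using assms(5) by auto
  then have "g (- \<beta>) \<le> g x" "g x \<le> g \<beta>"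
    using is_deriv_on_nondecreasing[OF assms(1,2)] by auto
  then show ?thesis using assms(3,4) by auto
qed

text \<open>The slope condition makes the map nondecreasing, and the signs of \<open>f\<close> at
  the end points push its extreme values inwards. The weight \<alpha> is 1 for the first-order
  schemes and a fraction for the outer part of LRI2.\<close>

lemma euler_map_abs_bound:
  assumes f: "is_deriv_on f f' {-\<beta>..\<beta>}"
    and slope: "\<And>x. x \<in> {-\<beta>..\<beta>} \<Longrightarrow> 0 \<le> \<alpha> + t * f' x"
    and "0 \<le> t" "f \<beta> \<le> 0" "0 \<le> f (- \<beta>)" "\<bar>x\<bar> \<le> \<beta>"
  shows "\<bar>\<alpha> * x + t * f x\<bar> \<le> \<alpha> * \<beta>"
proof (rule is_deriv_on_abs_bound[where g = "\<lambda>x. \<alpha> * x + t * f x"])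
  show "is_deriv_on (\<lambda>x. \<alpha> * x + t * f x) (\<lambda>x. \<alpha> + t * f' x) {-\<beta>..\<beta>}"
    using f by (auto simp: is_deriv_on_def intro!: derivative_eq_intros)
qed (use assms in \<open>auto simp: mult_nonneg_nonpos\<close>)

text \<open>The condition \<open>slope\<close> says that the derivative of the map is nonnegative,
  where \<open>f'' x * f x + f' x * f' x\<close> is the derivative of \<open>f' x * f x\<close>. The
  condition \<open>step\<close> controls the signs at the end points.\<close>

lemma euler_map_second_order_abs_bound:
  assumes f: "is_deriv_on f f' {-\<beta>..\<beta>}" and f': "is_deriv_on f' f'' {-\<beta>..\<beta>}"
    and slope: "\<And>x. x \<in> {-\<beta>..\<beta>} \<Longrightarrow>
      0 \<le> \<alpha> + t / 2 * f' x + t\<^sup>2 / 2 * (f'' x * f x + f' x * f' x)"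
    and step: "\<And>x. x \<in> {-\<beta>..\<beta>} \<Longrightarrow> 0 \<le> 1 + t * f' x"
    and "0 \<le> t" "f \<beta> \<le> 0" "0 \<le> f (- \<beta>)" "\<bar>x\<bar> \<le> \<beta>"
  shows "\<bar>\<alpha> * x + t / 2 * f x + t\<^sup>2 / 2 * (f' x * f x)\<bar> \<le> \<alpha> * \<beta>"
proof (rule is_deriv_on_abs_bound[where g = "\<lambda>x. \<alpha> * x + t / 2 * f x + t\<^sup>2 / 2 * (f' x * f x)"])
  show "is_deriv_on (\<lambda>x. \<alpha> * x + t / 2 * f x + t\<^sup>2 / 2 * (f' x * f x))
      (\<lambda>x. \<alpha> + t / 2 * f' x + t\<^sup>2 / 2 * (f'' x * f x + f' x * f' x)) {-\<beta>..\<beta>}"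
    unfolding is_deriv_on_def
  proof
    fix x assume x: "x \<in> {-\<beta>..\<beta>}"
    have [derivative_intros]:
      "(f has_real_derivative f' x) (at x within {-\<beta>..\<beta>})"
      "(f' has_real_derivative f'' x) (at x within {-\<beta>..\<beta>})"
      using f f' x by (auto simp: is_deriv_on_def)
    show "((\<lambda>x. \<alpha> * x + t / 2 * f x + t\<^sup>2 / 2 * (f' x * f x)) has_real_derivative
        \<alpha> + t / 2 * f' x + t\<^sup>2 / 2 * (f'' x * f x + f' x * f' x)) (at x within {-\<beta>..\<beta>})"
      by (rule derivative_eq_intros refl)+ (simp add: algebra_simps)
  qed
  \<comment> \<open>Factoring out \<open>f x\<close> leaves a coefficient that is nonnegative by
    \<open>step\<close>, so the end point values are decided by the sign of \<open>f\<close>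
    alone.\<close>
  have eq: "\<alpha> * x + t / 2 * f x + t\<^sup>2 / 2 * (f' x * f x) = \<alpha> * x + t / 2 * (1 + t * f' x) * f x" for x
    by (simp add: algebra_simps power2_eq_square)
  have "0 \<le> \<beta>" using assms(8) by simp
  then have "0 \<le> t / 2 * (1 + t * f' \<beta>)" "0 \<le> t / 2 * (1 + t * f' (- \<beta>))"
    using step \<open>0 \<le> t\<close> by auto
  then show "\<alpha> * \<beta> + t / 2 * f \<beta> + t\<^sup>2 / 2 * (f' \<beta> * f \<beta>) \<le> \<alpha> * \<beta>"
    and "- (\<alpha> * \<beta>) \<le> \<alpha> * - \<beta> + t / 2 * f (- \<beta>) + t\<^sup>2 / 2 * (f' (- \<beta>) * f (- \<beta>))"
    unfolding eq using assms(6,7) by (auto intro: mult_nonneg_nonpos)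
qed (use slope assms(8) in auto)

section \<open>One step of each scheme preserves the box\<close>

lemma LRI1a_step_box:
  assumes "row_stochastic n (mat_exp (dt \<cdot>\<^sub>m A))" "u \<in> box_vecs n \<beta>"
    and "\<And>x. \<bar>x\<bar> \<le> \<beta> \<Longrightarrow> \<bar>x + dt * f x\<bar> \<le> \<beta>"
  shows "LRI1a_step A f dt u \<in> box_vecs n \<beta>"
  unfolding LRI1a_step_def
  using assms by (intro row_stochastic_mult_box) (auto simp: box_vecs_def)

lemma LRI1b_step_box:
  assumes "row_stochastic n (mat_exp (dt \<cdot>\<^sub>m A))" "u \<in> box_vecs n \<beta>"
    and "\<And>x. \<bar>x\<bar> \<le> \<beta> \<Longrightarrow> \<bar>x + dt * f x\<bar> \<le> \<beta>"
  shows "LRI1b_step A f dt u \<in> box_vecs n \<beta>"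
proof -
  define v where "v = mat_exp (dt \<cdot>\<^sub>m A) *\<^sub>v u"
  have "v \<in> box_vecs n \<beta>"
    unfolding v_def using row_stochastic_mult_box assms by blast
  then have "v + dt \<cdot>\<^sub>v map_vec f v \<in> box_vecs n \<beta>"
    using assms(3) by (auto simp: box_vecs_def)
  then show ?thesis by (simp add: LRI1b_step_def v_def)
qed

text \<open>
  The term \<open>v = exp (dt A) u\<close> of the scheme is split into \<open>\<alpha> v + (1 - \<alpha>) v\<close>;
  the first part is combined with \<open>f v\<close>, the second with the terms inside the exponential.
\<close>

lemma LRI2_step_box:
  assumes P: "row_stochastic n (mat_exp (dt \<cdot>\<^sub>m A))" and u: "u \<in> box_vecs n \<beta>"
    and outer: "\<And>x. \<bar>x\<bar> \<le> \<beta> \<Longrightarrow> \<bar>\<alpha> * x + dt / 2 * f x\<bar> \<le> \<alpha> * \<beta>"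
    and inner: "\<And>x. \<bar>x\<bar> \<le> \<beta> \<Longrightarrow>
      \<bar>(1 - \<alpha>) * x + dt / 2 * f x + dt\<^sup>2 / 2 * (f' x * f x)\<bar> \<le> (1 - \<alpha>) * \<beta>"
  shows "LRI2_step A f f' dt u \<in> box_vecs n \<beta>"
proof -
  define P where "P = mat_exp (dt \<cdot>\<^sub>m A)"
  define v where "v = P *\<^sub>v u"
  have Pc: "P \<in> carrier_mat n n" using P by (simp add: row_stochastic_def P_def)
  have uc: "u \<in> carrier_vec n" and ub: "\<And>j. j < n \<Longrightarrow> \<bar>u $ j\<bar> \<le> \<beta>"
    using u by (auto simp: box_vecs_def)
  have v: "v \<in> box_vecs n \<beta>"
    unfolding v_def P_def by (rule row_stochastic_mult_box[OF P u])
  have vc: "v \<in> carrier_vec n" using v by (simp add: box_vecs_def)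
  have J: "jacobian_vec f' u *\<^sub>v map_vec f u = Matrix.vec n (\<lambda>i. f' (u $ i) * f (u $ i))"
  proof (rule eq_vecI)
    fix i assume "i < dim_vec (Matrix.vec n (\<lambda>i. f' (u $ i) * f (u $ i)))"
    then have i: "i < n" by simp
    have "(jacobian_vec f' u *\<^sub>v map_vec f u) $ i
        = (\<Sum>k<n. jacobian_vec f' u $$ (i, k) * map_vec f u $ k)"
      using uc i by (intro mult_mat_vec_entry) (auto simp: jacobian_vec_def mat_diag_def)
    also have "\<dots> = (\<Sum>k<n. if k = i then f' (u $ i) * f (u $ i) else 0)"
      using uc i by (intro sum.cong) (auto simp: jacobian_vec_def mat_diag_def)
    finally show "(jacobian_vec f' u *\<^sub>v map_vec f u) $ i
        = Matrix.vec n (\<lambda>i. f' (u $ i) * f (u $ i)) $ i"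
      using i by simp
  qed (use uc in \<open>simp add: jacobian_vec_def mat_diag_def\<close>)
  have step: "LRI2_step A f f' dt u = v + (dt / 2) \<cdot>\<^sub>v (P *\<^sub>v map_vec f u + map_vec f v)
      + (dt\<^sup>2 / 2) \<cdot>\<^sub>v (P *\<^sub>v Matrix.vec n (\<lambda>i. f' (u $ i) * f (u $ i)))"
    by (simp add: LRI2_step_def J P_def v_def)
  have "\<bar>LRI2_step A f f' dt u $ i\<bar> \<le> \<beta>" if i: "i < n" for i
  proof -
    let ?g = "\<lambda>x. (1 - \<alpha>) * x + dt / 2 * f x + dt\<^sup>2 / 2 * (f' x * f x)"
    have 1: "(P *\<^sub>v map_vec f u) $ i = (\<Sum>j<n. P $$ (i, j) * f (u $ j))"
      using mult_mat_vec_entry[OF Pc _ i, of "map_vec f u"] uc by simp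
    have 2: "(P *\<^sub>v Matrix.vec n (\<lambda>i. f' (u $ i) * f (u $ i))) $ i
        = (\<Sum>j<n. P $$ (i, j) * (f' (u $ j) * f (u $ j)))"
      using mult_mat_vec_entry[OF Pc _ i, of "Matrix.vec n (\<lambda>i. f' (u $ i) * f (u $ i))"] by simp
    have 3: "v $ i = (\<Sum>j<n. P $$ (i, j) * u $ j)"
      unfolding v_def by (rule mult_mat_vec_entry[OF Pc uc i])
    have "LRI2_step A f f' dt u $ i = v $ i
        + dt / 2 * ((\<Sum>j<n. P $$ (i, j) * f (u $ j)) + f (v $ i))
        + dt\<^sup>2 / 2 * (\<Sum>j<n. P $$ (i, j) * (f' (u $ j) * f (u $ j)))"
      unfolding step using i Pc vc by (simp add: 1 2 del: index_mult_mat_vec)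
    also have "\<dots> = (\<alpha> * v $ i + dt / 2 * f (v $ i)) + (1 - \<alpha>) * v $ i
        + dt / 2 * (\<Sum>j<n. P $$ (i, j) * f (u $ j))
        + dt\<^sup>2 / 2 * (\<Sum>j<n. P $$ (i, j) * (f' (u $ j) * f (u $ j)))"
      by (simp add: algebra_simps)
    also have "\<dots> = (\<alpha> * v $ i + dt / 2 * f (v $ i)) + (\<Sum>j<n. P $$ (i, j) * ?g (u $ j))"
    proof -
      have "(\<Sum>j<n. P $$ (i, j) * ?g (u $ j))
          = (\<Sum>j<n. (1 - \<alpha>) * (P $$ (i, j) * u $ j) + dt / 2 * (P $$ (i, j) * f (u $ j))
              + dt\<^sup>2 / 2 * (P $$ (i, j) * (f' (u $ j) * f (u $ j))))"
        by (intro sum.cong refl) (simp add: algebra_simps)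
      then show ?thesis by (simp only: 3 sum.distrib sum_distrib_left add.assoc)
    qed
    finally have "LRI2_step A f f' dt u $ i
        = (\<alpha> * v $ i + dt / 2 * f (v $ i)) + (\<Sum>j<n. P $$ (i, j) * ?g (u $ j))" .
    moreover have "\<bar>\<alpha> * v $ i + dt / 2 * f (v $ i)\<bar> \<le> \<alpha> * \<beta>"
      using v i by (intro outer) (simp add: box_vecs_def)
    moreover have "\<bar>\<Sum>j<n. P $$ (i, j) * ?g (u $ j)\<bar> \<le> (1 - \<alpha>) * \<beta>"
      using P i ub by (intro row_stochastic_average_bound inner) (auto simp: P_def)
    \<comment> \<open>The radii of the two parts add up exactly to \<beta>, for any splitting
      weight.\<close>
    moreover have "\<alpha> * \<beta> + (1 - \<alpha>) * \<beta> = \<beta>" by (simp add: algebra_simps)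
    ultimately show ?thesis by linarith
  qed
  moreover have "LRI2_step A f f' dt u \<in> carrier_vec n"
    unfolding step using carrier_matD(1)[OF Pc] by (intro carrier_vecI) simp
  ultimately show ?thesis by (simp add: box_vecs_def)
qed

lemma generated_by_invariant:
  assumes "generated_by step M U" "U 0 \<in> S" "\<And>u. u \<in> S \<Longrightarrow> step u \<in> S" "m \<le> M"
  shows "U m \<in> S"
  using \<open>m \<le> M\<close> by (induction m) (use assms in \<open>auto simp: generated_by_def\<close>)

section \<open>Step size restrictions\<close>

text \<open>Supplies the boundedness without which a real \<open>INF\<close> carries no information;
  it serves the infima in the constants and later the bound on \<open>F\<close>.\<close>

lemma continuous_on_Icc_bdd_below:
  fixes g :: "real \<Rightarrow> real"
  assumes "continuous_on {a..b} g"
  shows "bdd_below (g ` {a..b})"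
proof (cases "a \<le> b")
  case True
  then obtain z where "\<forall>x\<in>{a..b}. g z \<le> g x"
    using continuous_attains_inf[OF compact_Icc _ assms] by auto
  then show ?thesis by (auto intro: bdd_belowI)
qed simp

text \<open>With \<open>I\<close> the infimum of \<open>f'\<close>, which is negative, the chain is
  \<open>t * f' x \<ge> t * I \<ge> \<alpha> * omega0 \<beta> f' * I = - \<alpha>\<close>.\<close>

lemma omega0_slope:
  assumes c: "continuous_on {-\<beta>..\<beta>} f'" and w: "0 < omega0 \<beta> f'"
    and x: "x \<in> {-\<beta>..\<beta>}" and t: "0 \<le> t" "t \<le> \<alpha> * omega0 \<beta> f'"
  shows "0 \<le> \<alpha> + t * f' x"
proof -
  let ?I = "INF x\<in>{-\<beta>..\<beta>}. f' x" and ?w = "omega0 \<beta> f'"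
  have "?I \<le> f' x" by (rule cINF_lower[OF continuous_on_Icc_bdd_below[OF c] x])
  then have "t * ?I \<le> t * f' x" using t by (simp add: mult_left_mono)
  \<comment> \<open>Positivity of \<open>?w\<close> excludes \<open>?I = 0\<close>, because division
    by zero yields 0.\<close>
  moreover have "?w * ?I = -1" using w by (auto simp: omega0_def)
  moreover have "?I < 0" using w by (auto simp: omega0_def divide_less_0_iff)
  then have "\<alpha> * ?w * ?I \<le> t * ?I" using t by (simp add: mult_right_mono_neg)
  ultimately show ?thesis by (simp add: mult.assoc)
qed

lemma omega1_lower_bound:
  assumes "continuous_on {-\<beta>..\<beta>} f" "continuous_on {-\<beta>..\<beta>} f''" and x: "x \<in> {-\<beta>..\<beta>}"
  shows "- omega1 \<beta> f f'' \<le> f'' x * f x"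
proof -
  have "continuous_on {-\<beta>..\<beta>} (\<lambda>x. f'' x * f x)"
    using assms by (intro continuous_intros)
  from cINF_lower[OF continuous_on_Icc_bdd_below[OF this] x] show ?thesis
    by (simp add: omega1_def)
qed

text \<open>
  For \<open>\<omega>\<^sub>1 > 0\<close>, \<open>\<delta>\<close> is the positive root of \<open>\<omega>\<^sub>0\<^sup>2 \<omega>\<^sub>1 \<delta>\<^sup>2 + \<delta> = 7/4\<close>.
\<close>

lemma delta0_bounds:
  fixes \<beta> f f' f''
  defines "\<delta> \<equiv> delta0 \<beta> f f' f''" and "w0 \<equiv> omega0 \<beta> f'" and "w1 \<equiv> omega1 \<beta> f f''"
  assumes t: "0 < t" "t \<le> \<delta> * w0"
  shows "0 < w0" "\<delta> \<le> 1" "t\<^sup>2 * w1 + \<delta> \<le> 7 / 4"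
proof -
  define r where "r = sqrt (1 + 7 * w0\<^sup>2 * w1)"
  have \<delta>: "\<delta> = (if w1 > 0 then min 1 ((- 1 + r) / (2 * w0\<^sup>2 * w1)) else 1)"
    by (simp add: delta0_def Let_def \<delta>_def w0_def w1_def r_def)
  then show "\<delta> \<le> 1" by simp
  \<comment> \<open>At this point \<open>w0\<close> may still be zero; the quotient defining
    \<delta> is then 0 by convention, so \<delta> is nonnegative in every case.\<close>
  have "1 \<le> r" if "w1 > 0" using that by (simp add: r_def)
  then have "0 \<le> \<delta>" by (simp add: \<delta>)
  moreover have "0 < \<delta> * w0" using t by linarith
  ultimately show "0 < w0" by (simp add: zero_less_mult_iff)
  show "t\<^sup>2 * w1 + \<delta> \<le> 7 / 4"
  proof (cases "w1 > 0")
    case False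
    then have "t\<^sup>2 * w1 \<le> 0" by (simp add: mult_nonneg_nonpos)
    then show ?thesis using \<open>\<delta> \<le> 1\<close> by linarith
  next
    case True
    define w where "w = w0\<^sup>2 * w1"
    define q where "q = (r - 1) / (2 * w)"
    have w: "0 < w" using True \<open>0 < w0\<close> by (simp add: w_def)
    have r2: "r\<^sup>2 = 1 + 7 * w" using w by (simp add: r_def w_def mult.assoc)
    have "\<delta> \<le> q" using True by (simp add: \<delta> q_def w_def mult.assoc)
    have "t\<^sup>2 \<le> (\<delta> * w0)\<^sup>2" using t by (intro power_mono) auto
    then have "t\<^sup>2 * w1 \<le> \<delta>\<^sup>2 * w"
      using True by (simp add: w_def power_mult_distrib mult.assoc[symmetric] mult_right_mono)
    also have "\<dots> \<le> q\<^sup>2 * w"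
      using \<open>\<delta> \<le> q\<close> \<open>0 \<le> \<delta>\<close> w by (intro mult_right_mono power_mono) auto
    finally have "t\<^sup>2 * w1 + \<delta> \<le> q\<^sup>2 * w + q" using \<open>\<delta> \<le> q\<close> by linarith
    \<comment> \<open>Both terms share the factor \<open>(r - 1) / (4 * w)\<close>, with remaining
      factor \<open>(r - 1) + 2 = r + 1\<close>.\<close>
    also have "q\<^sup>2 * w + q = (r\<^sup>2 - 1) / (4 * w)"
      using w by (simp add: q_def field_simps power2_eq_square)
    also have "\<dots> = 7 / 4" using w by (simp add: r2)
    finally show ?thesis .
  qed
qed

section \<open>Scalar bounds under the step size restrictions\<close>

lemma LRI1_scalar_bound:
  assumes f: "C1_deriv_on f f' {-\<beta>..\<beta>}" and dt: "0 < dt" "dt \<le> omega0 \<beta> f'"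
    and "f \<beta> \<le> 0" "0 \<le> f (- \<beta>)" "\<bar>x\<bar> \<le> \<beta>"
  shows "\<bar>x + dt * f x\<bar> \<le> \<beta>"
proof -
  have "0 \<le> 1 + dt * f' x" if "x \<in> {-\<beta>..\<beta>}" for x
    using f dt that by (intro omega0_slope[where \<beta> = \<beta>]) (auto simp: C1_deriv_on_def)
  then show ?thesis
    using euler_map_abs_bound[of f f' \<beta> 1 dt x] assms by (auto simp: C1_deriv_on_def)
qed

text \<open>The weight is the one for which the outer map with step \<open>dt / 2\<close> satisfies
  its slope condition exactly when \<open>dt\<close> is at most \<open>delta0\<close> times
  \<open>omega0\<close>. What is left for the inner map is settled by completing a square.\<close>

lemma LRI2_scalar_bounds:
  fixes \<beta> f f' f''
  defines "\<alpha> \<equiv> delta0 \<beta> f f' f'' / 2"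
  assumes f: "C1_deriv_on f f' {-\<beta>..\<beta>}" and f': "C1_deriv_on f' f'' {-\<beta>..\<beta>}"
    and dt: "0 < dt" "dt \<le> delta0 \<beta> f f' f'' * omega0 \<beta> f'"
    and "f \<beta> \<le> 0" "0 \<le> f (- \<beta>)" "\<bar>x\<bar> \<le> \<beta>"
  shows "\<bar>\<alpha> * x + dt / 2 * f x\<bar> \<le> \<alpha> * \<beta>"
    and "\<bar>(1 - \<alpha>) * x + dt / 2 * f x + dt\<^sup>2 / 2 * (f' x * f x)\<bar> \<le> (1 - \<alpha>) * \<beta>"
proof -
  note b = delta0_bounds[OF dt]
  have c: "continuous_on {-\<beta>..\<beta>} f'" "continuous_on {-\<beta>..\<beta>} f''"
    and d: "is_deriv_on f f' {-\<beta>..\<beta>}" "is_deriv_on f' f'' {-\<beta>..\<beta>}"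
    using f f' by (auto simp: C1_deriv_on_def)
  have cf: "continuous_on {-\<beta>..\<beta>} f"
    using d(1) by (auto simp: is_deriv_on_def intro: DERIV_continuous_on)
  have s: "0 \<le> 2 * \<alpha> + dt * f' x" if "x \<in> {-\<beta>..\<beta>}" for x
    unfolding \<alpha>_def using omega0_slope[OF c(1) b(1) that] dt by simp
  then have s1: "0 \<le> \<alpha> + dt / 2 * f' x" if "x \<in> {-\<beta>..\<beta>}" for x
    using s[OF that] by simp
  then show "\<bar>\<alpha> * x + dt / 2 * f x\<bar> \<le> \<alpha> * \<beta>"
    using assms d by (intro euler_map_abs_bound) auto
  show "\<bar>(1 - \<alpha>) * x + dt / 2 * f x + dt\<^sup>2 / 2 * (f' x * f x)\<bar> \<le> (1 - \<alpha>) * \<beta>"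
  proof (rule euler_map_second_order_abs_bound[OF d])
    fix x assume x: "x \<in> {-\<beta>..\<beta>}"
    \<comment> \<open>\<open>s\<close> gives this with \<open>delta0\<close> in place of 1, and
      \<open>delta0\<close> is at most 1.\<close>
    show "0 \<le> 1 + dt * f' x" using s[OF x] b(2) by (simp add: \<alpha>_def)
    have "dt\<^sup>2 * (- omega1 \<beta> f f'') \<le> dt\<^sup>2 * (f'' x * f x)"
      using omega1_lower_bound[OF cf c(2) x] by (intro mult_left_mono) auto
    then have "- (dt\<^sup>2 * omega1 \<beta> f f'') \<le> dt\<^sup>2 * (f'' x * f x)" by simp
    \<comment> \<open>Completing the square costs \<open>1 / 4\<close>, which leaves
      \<open>2 - 1 / 4 = 7 / 4\<close> to absorb \<open>delta0\<close> and the \<open>omega1\<close>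
      term; this is where the 7 in \<open>delta0\<close> comes from.\<close>
    moreover have "0 \<le> (dt * f' x + 1 / 2)\<^sup>2" by simp
    moreover have "(dt * f' x + 1 / 2)\<^sup>2 = dt\<^sup>2 * (f' x * f' x) + dt * f' x + 1 / 4"
      by (simp add: power2_eq_square algebra_simps)
    ultimately have "0 \<le> 2 - 2 * \<alpha> + dt * f' x + dt\<^sup>2 * (f'' x * f x) + dt\<^sup>2 * (f' x * f' x)"
      using b(3) unfolding \<alpha>_def by linarith
    moreover have "(1 - \<alpha>) + dt / 2 * f' x + dt\<^sup>2 / 2 * (f'' x * f x + f' x * f' x)
        = (2 - 2 * \<alpha> + dt * f' x + dt\<^sup>2 * (f'' x * f x) + dt\<^sup>2 * (f' x * f' x)) / 2"
      by (simp add: field_simps)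
    ultimately show "0 \<le> (1 - \<alpha>) + dt / 2 * f' x + dt\<^sup>2 / 2 * (f'' x * f x + f' x * f' x)"
      by (simp only: divide_nonneg_pos zero_less_numeral)
  qed (use assms in auto)
qed

section \<open>Initial values and energy\<close>

text \<open>Reduction modulo \<open>ns ! k\<close> keeps each coordinate index at most
  \<open>ns ! k - 1\<close>, and the index \<open>ns ! k - 1\<close> lands exactly on
  \<open>b $ k\<close>.\<close>

lemma grid_point_in_closed_domain:
  assumes g: "uniform_grid d h ns a b"
  shows "grid_point h ns a i \<in> closed_domain a b"
proof -
  have "a $ k \<le> grid_point h ns a i $ k \<and> grid_point h ns a i $ k \<le> b $ k" if k: "k < d" for k
  proof -
    let ?r = "i div prod_list (take k ns) mod (ns ! k)"
    have "?r < ns ! k" using g k by (intro mod_less_divisor) (force simp: uniform_grid_def)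
    then have "real ?r \<le> real (ns ! k) - 1" by linarith
    then have "h * real ?r \<le> h * (real (ns ! k) - 1)"
      using g by (intro mult_left_mono) (auto simp: uniform_grid_def)
    moreover have "b $ k - a $ k = h * (real (ns ! k) - 1)"
      using g k by (simp add: uniform_grid_def)
    moreover have "0 \<le> h * real ?r" using g by (simp add: uniform_grid_def)
    moreover have "grid_point h ns a i $ k = a $ k + h * real ?r"
      using g k by (simp add: grid_point_def uniform_grid_def)
    ultimately show ?thesis by linarith
  qed
  then show ?thesis using g by (auto simp: closed_domain_def uniform_grid_def grid_point_def)
qed

lemma grid_values_box:
  assumes "uniform_grid d h ns a b" "sup_norm_on (closed_domain a b) u0 \<le> ereal \<beta>"
  shows "grid_values h ns a u0 \<in> box_vecs (prod_list ns) \<beta>"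
proof -
  have "\<bar>u0 x\<bar> \<le> \<beta>" if "x \<in> closed_domain a b" for x
    using assms(2) that by (auto simp: sup_norm_on_def SUP_le_iff)
  then show ?thesis
    using grid_point_in_closed_domain[OF assms(1)] by (auto simp: box_vecs_def grid_values_def)
qed

lemma discrete_energy_bounded_on_box:
  assumes F: "continuous_on {-\<beta>..\<beta>} F" and D: "D_mat h ns \<in> carrier_mat (prod_list ns) (prod_list ns)"
  shows "\<exists>K. \<forall>u\<in>box_vecs (prod_list ns) \<beta>. \<bar>discrete_energy F eps h ns u\<bar> \<le> K"
proof -
  define n where "n = prod_list ns"
  have D': "D_mat h ns \<in> carrier_mat n n" using D by (simp add: n_def)
  \<comment> \<open>A lower bound for the negated absolute value is an upper bound for the absolute
    value of \<open>F\<close>.\<close>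
  have "bdd_below ((\<lambda>x. - \<bar>F x\<bar>) ` {-\<beta>..\<beta>})"
    by (intro continuous_on_Icc_bdd_below continuous_intros F)
  then obtain L where L: "\<forall>y\<in>(\<lambda>x. - \<bar>F x\<bar>) ` {-\<beta>..\<beta>}. L \<le> y"
    unfolding bdd_below_def ..
  define B where "B = - L"
  have B: "\<bar>F x\<bar> \<le> B" if "\<bar>x\<bar> \<le> \<beta>" for x
  proof -
    have "x \<in> {-\<beta>..\<beta>}" using that by auto
    from bspec[OF L imageI[OF this]] show ?thesis by (simp add: B_def)
  qed
  \<comment> \<open>Bounds every summand separately; it depends on the grid, \<open>eps\<close>,
    \<beta> and \<open>F\<close>, but not on any time step.\<close>
  define K where "K = real n * B + eps\<^sup>2 / 2 * (\<Sum>i<n. \<Sum>j<n. \<beta> * (\<bar>D_mat h ns $$ (i, j)\<bar> * \<beta>))"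
  have "\<bar>discrete_energy F eps h ns u\<bar> \<le> K" if u: "u \<in> box_vecs n \<beta>" for u
  proof -
    have uc: "u \<in> carrier_vec n" and ub: "\<And>i. i < n \<Longrightarrow> \<bar>u $ i\<bar> \<le> \<beta>"
      using u by (auto simp: box_vecs_def)
    have "\<bar>\<Sum>i<n. F (u $ i)\<bar> \<le> (\<Sum>i<n. B)"
      using ub B by (intro order_trans[OF sum_abs] sum_mono) auto
    then have 1: "\<bar>\<Sum>i<n. F (u $ i)\<bar> \<le> real n * B" by simp
    have "scalar_prod u (D_mat h ns *\<^sub>v u) = (\<Sum>i<n. \<Sum>j<n. u $ i * (D_mat h ns $$ (i, j) * u $ j))"
      using D' mult_mat_vec_entry[OF D' uc]
      by (simp add: scalar_prod_def lessThan_atLeast0 sum_distrib_left del: index_mult_mat_vec)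
    also have "\<bar>\<dots>\<bar> \<le> (\<Sum>i<n. \<Sum>j<n. \<beta> * (\<bar>D_mat h ns $$ (i, j)\<bar> * \<beta>))"
    proof (intro order_trans[OF sum_abs] sum_mono)
      fix i j assume "i \<in> {..<n}" "j \<in> {..<n}"
      then have "\<bar>u $ i\<bar> \<le> \<beta>" "\<bar>u $ j\<bar> \<le> \<beta>" using ub by auto
      then show "\<bar>u $ i * (D_mat h ns $$ (i, j) * u $ j)\<bar> \<le> \<beta> * (\<bar>D_mat h ns $$ (i, j)\<bar> * \<beta>)"
        unfolding abs_mult by (intro mult_mono) auto
    qed
    finally have "\<bar>eps\<^sup>2 / 2 * scalar_prod u (D_mat h ns *\<^sub>v u)\<bar>
        \<le> eps\<^sup>2 / 2 * (\<Sum>i<n. \<Sum>j<n. \<beta> * (\<bar>D_mat h ns $$ (i, j)\<bar> * \<beta>))"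
      unfolding abs_mult by (simp add: mult_left_mono)
    then show ?thesis
      using 1 unfolding discrete_energy_def K_def n_def[symmetric] by linarith
  qed
  then show ?thesis unfolding n_def by blast
qed

theorem theorem4:
  fixes d :: nat and ns :: "nat list" and a b :: "real Matrix.vec"
    and h eps T \<beta> :: real
    and u0 :: "real Matrix.vec \<Rightarrow> real"
    and f f' f'' F :: "real \<Rightarrow> real"
  assumes "d \<in> {1, 2, 3}"
    and "uniform_grid d h ns a b"
    and "eps > 0" and "T > 0" and "\<beta> > 0"
    and "f \<beta> \<le> 0" and "0 \<le> f (- \<beta>)"
    and "is_deriv_on F (\<lambda>x. - f x) {-\<beta>..\<beta>}"
    and "sup_norm_on (closed_domain a b) u0 \<le> ereal \<beta>"
  shows "\<exists>C>0. \<forall>(M::nat) (dt::real) (U :: nat \<Rightarrow> real Matrix.vec).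
    M > 0 \<and> dt = T / real M \<and> U 0 = grid_values h ns a u0 \<and>
    ((C1_deriv_on f f' {-\<beta>..\<beta>} \<and> nonconstant_on f {-\<beta>..\<beta>} \<and>
      0 < dt \<and> dt \<le> omega0 \<beta> f' \<and>
      (generated_by (LRI1a_step (A_mat eps h ns) f dt) M U \<or>
       generated_by (LRI1b_step (A_mat eps h ns) f dt) M U))
     \<or>
     (C1_deriv_on f f' {-\<beta>..\<beta>} \<and> C1_deriv_on f' f'' {-\<beta>..\<beta>} \<and>
      nonconstant_on f {-\<beta>..\<beta>} \<and>
      0 < dt \<and> dt \<le> delta0 \<beta> f f' f'' * omega0 \<beta> f' \<and>
      generated_by (LRI2_step (A_mat eps h ns) f f' dt) M U))
    \<longrightarrow> (\<forall>m\<le>M. discrete_energy F eps h ns (U m) \<le> discrete_energy F eps h ns (U 0) + C)"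
proof -
  define n where "n = prod_list ns"
  have ns: "length ns \<in> {1, 2, 3}" "\<forall>k<length ns. 2 \<le> ns ! k"
    using assms(1,2) by (auto simp: uniform_grid_def)
  have D: "rate_matrix n (D_mat h ns)"
    unfolding n_def by (rule rate_matrix_D_mat[OF ns])
  have P: "row_stochastic n (mat_exp (dt \<cdot>\<^sub>m A_mat eps h ns))" if "0 < dt" for dt
    using that D unfolding A_mat_def by (intro row_stochastic_mat_exp rate_matrix_smult) auto
  have init: "grid_values h ns a u0 \<in> box_vecs n \<beta>"
    unfolding n_def by (rule grid_values_box[OF assms(2,9)])
  have "continuous_on {-\<beta>..\<beta>} F"
    using assms(8) by (auto simp: is_deriv_on_def intro: DERIV_continuous_on)
  then obtain K where K: "\<And>u. u \<in> box_vecs n \<beta> \<Longrightarrow> \<bar>discrete_energy F eps h ns u\<bar> \<le> K"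
    using discrete_energy_bounded_on_box[of \<beta> F h ns eps] D
    by (auto simp: rate_matrix_def n_def)
  \<comment> \<open>The box contains the initial values, so \<open>K\<close> bounds at least one
    absolute value.\<close>
  have K0: "0 \<le> K" using K[OF init] by linarith
  show ?thesis
  \<comment> \<open>Two energies in \<open>[-K, K]\<close> differ by at most \<open>2 * K\<close>;
    the extra 1 gives strict positivity even when \<open>K = 0\<close>. The constant is fixed before
    \<open>M\<close>, \<open>dt\<close> and \<open>U\<close>, hence independent of the time
    step.\<close>
  proof (intro exI[of _ "2 * K + 1"] conjI allI impI)
    show "0 < 2 * K + 1" using K0 by simp
  next
    fix M dt and U :: "nat \<Rightarrow> real Matrix.vec" and m
    assume H: "M > 0 \<and> dt = T / real M \<and> U 0 = grid_values h ns a u0 \<and>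
      ((C1_deriv_on f f' {-\<beta>..\<beta>} \<and> nonconstant_on f {-\<beta>..\<beta>} \<and>
        0 < dt \<and> dt \<le> omega0 \<beta> f' \<and>
        (generated_by (LRI1a_step (A_mat eps h ns) f dt) M U \<or>
         generated_by (LRI1b_step (A_mat eps h ns) f dt) M U))
       \<or>
       (C1_deriv_on f f' {-\<beta>..\<beta>} \<and> C1_deriv_on f' f'' {-\<beta>..\<beta>} \<and>
        nonconstant_on f {-\<beta>..\<beta>} \<and>
        0 < dt \<and> dt \<le> delta0 \<beta> f f' f'' * omega0 \<beta> f' \<and>
        generated_by (LRI2_step (A_mat eps h ns) f f' dt) M U))"
      and m: "m \<le> M"
    have U0: "U 0 \<in> box_vecs n \<beta>" using H init by simp
    consider
      (LRI1a) "C1_deriv_on f f' {-\<beta>..\<beta>}" "0 < dt" "dt \<le> omega0 \<beta> f'"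
        "generated_by (LRI1a_step (A_mat eps h ns) f dt) M U"
    | (LRI1b) "C1_deriv_on f f' {-\<beta>..\<beta>}" "0 < dt" "dt \<le> omega0 \<beta> f'"
        "generated_by (LRI1b_step (A_mat eps h ns) f dt) M U"
    | (LRI2) "C1_deriv_on f f' {-\<beta>..\<beta>}" "C1_deriv_on f' f'' {-\<beta>..\<beta>}" "0 < dt"
        "dt \<le> delta0 \<beta> f f' f'' * omega0 \<beta> f'"
        "generated_by (LRI2_step (A_mat eps h ns) f f' dt) M U"
      using H by blast
    then have "U m \<in> box_vecs n \<beta>"
    proof cases
      case LRI1a
      show ?thesis
        by (rule generated_by_invariant[OF LRI1a(4) U0 LRI1a_step_box[OF P[OF LRI1a(2)]] m])
          (use LRI1_scalar_bound[OF LRI1a(1-3) assms(6,7)] in auto)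
    next
      case LRI1b
      show ?thesis
        by (rule generated_by_invariant[OF LRI1b(4) U0 LRI1b_step_box[OF P[OF LRI1b(2)]] m])
          (use LRI1_scalar_bound[OF LRI1b(1-3) assms(6,7)] in auto)
    next
      case LRI2
      show ?thesis
        by (rule generated_by_invariant[OF LRI2(5) U0 LRI2_step_box[OF P[OF LRI2(3)]] m])
          (use LRI2_scalar_bounds[OF LRI2(1-4) assms(6,7)] in auto)
    qed
    then show "discrete_energy F eps h ns (U m) \<le> discrete_energy F eps h ns (U 0) + (2 * K + 1)"
      using K[of "U m"] K[OF U0] by linarith
  qed
qed

end
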